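(* Let $\Sigma>0$, $H\in(0,1)$, $\delta>0$, and define $$Y_{\underline{n}}=\frac{1}{2\delta^H\sqrt{1-2^{H-2}}}\big(B_{\underline{n}+\delta\mathbf{e}_1}-B_{\underline{n}}+B_{\underline{n}+\delta\mathbf{e}_2}-B_{\underline{n}}\big),\qquad \underline{n}\in\Upsilon .$$ Then the field $Y=(Y_{\underline{n}})_{\underline{n}\in\Upsilon}$ is a zero-mean Gaussian process with variance $\mathbb{E}[Y_{\underline{n}}^2]=\Sigma^2$ and covariance $$\begin{aligned}\mathbb{E}\left[Y_{\underline{n}+\Delta\underline{n}}Y_{\underline{n}}\right]=\frac{\Sigma^2\delta^{-2H}}{4-2^H}\Big(&\|\Delta\underline{n}+\delta\mathbf{e}_1\|^{2H}+\|\Delta\underline{n}-\delta\mathbf{e}_1\|^{2H}+\|\Delta\underline{n}+\delta\mathbf{e}_2\|^{2H}+\|\Delta\underline{n}-\delta\mathbf{e}_2\|^{2H}-3\|\Delta\underline{n}\|^{2H}\\&-\tfrac12\|\Delta\underline{n}+\delta\mathbf{e}_1-\delta\mathbf{e}_2\|^{2H}-\tfrac12\|\Delta\underline{n}-\delta\mathbf{e}_1+\delta\mathbf{e}_2\|^{2H}\Big)\end{aligned}$$ for all $\underline{n},\underline{n}+\Delta\underline{n}\in\Upsilon$.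
   Context: $\Upsilon=\{1,\dots,N\}^2\subset\mathbb{R}^2$; $\mathbf{e}_1,\mathbf{e}_2$ are the unit vectors of $\mathbb{R}^2$ in the horizontal and vertical directions; $\|\cdot\|$ is the Euclidean norm on $\mathbb{R}^2$. $B=(B_{\underline{x}})_{\underline{x}\in\mathbb{R}^2}$ is the fractional Brownian field with parameters $(\Sigma,H)$, i.e. the zero-mean Gaussian field with covariance $$\mathbb{E}[B_{\underline{n}}B_{\underline{m}}]=\frac{\Sigma^2}{2}\big(\|\underline{n}\|^{2H}+\|\underline{m}\|^{2H}-\|\underline{n}-\underline{m}\|^{2H}\big).$$ *)

theory Defs
  imports "HOL-Probability.Probability"
begin

text \<open>
  Real Gaussian random variables, including the degenerate (almost surely constant) ones;
  the degenerate case cannot be dropped, since linear combinations of the components of a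
  Gaussian field may have variance zero (e.g. the fractional Brownian field at the origin).
\<close>

definition gaussian_rv :: "'a measure \<Rightarrow> ('a \<Rightarrow> real) \<Rightarrow> bool" where
  "gaussian_rv M X \<longleftrightarrow>
     X \<in> borel_measurable M \<and>
     ((\<exists>\<mu> \<sigma>. 0 < \<sigma> \<and> distributed M lborel X (normal_density \<mu> \<sigma>)) \<or>
      (\<exists>\<mu>. AE \<omega> in M. X \<omega> = \<mu>))"

text \<open>
  Joint Gaussianity: every finite linear combination is Gaussian. In particular every component
  has moments of all orders, so the Bochner integrals of components and of products of two
  components used below are those of integrable functions.
\<close>

definition gaussian_field :: "'a measure \<Rightarrow> 't set \<Rightarrow> ('t \<Rightarrow> 'a \<Rightarrow> real) \<Rightarrow> bool" where
  "gaussian_field M T X \<longleftrightarrow>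
     (\<forall>F a. finite F \<and> F \<subseteq> T \<longrightarrow> gaussian_rv M (\<lambda>\<omega>. \<Sum>t\<in>F. a t * X t \<omega>))"

definition zero_mean_gaussian_field :: "'a measure \<Rightarrow> 't set \<Rightarrow> ('t \<Rightarrow> 'a \<Rightarrow> real) \<Rightarrow> bool" where
  "zero_mean_gaussian_field M T X \<longleftrightarrow>
     gaussian_field M T X \<and> (\<forall>t\<in>T. (\<integral>\<omega>. X t \<omega> \<partial>M) = 0)"

definition fractional_brownian_field ::
    "'a measure \<Rightarrow> real \<Rightarrow> real \<Rightarrow> (real^2 \<Rightarrow> 'a \<Rightarrow> real) \<Rightarrow> bool" where
  "fractional_brownian_field M \<Sigma> H B \<longleftrightarrow>
     zero_mean_gaussian_field M UNIV B \<and>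
     (\<forall>n m. (\<integral>\<omega>. B n \<omega> * B m \<omega> \<partial>M) =
        \<Sigma>\<^sup>2 / 2 * (norm n powr (2 * H) + norm m powr (2 * H) - norm (n - m) powr (2 * H)))"

definition \<Upsilon> :: "nat \<Rightarrow> (real^2) set" where
  "\<Upsilon> N = {n. \<forall>i. n $ i \<in> real ` {1..N}}"

abbreviation e1 :: "real^2" where "e1 \<equiv> axis 1 1"

abbreviation e2 :: "real^2" where "e2 \<equiv> axis 2 1"

end

theory Submission
  imports Defs
begin

text \<open>
  Up to a constant, each \<open>Y n\<close> is the sum of the two increments of \<open>B\<close> from \<open>n\<close> to
  \<open>n + \<delta> *\<^sub>R e1\<close> and to \<open>n + \<delta> *\<^sub>R e2\<close>. A finite linear combination of the \<open>Y n\<close> is therefore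
  a finite linear combination of values of \<open>B\<close>, so \<open>Y\<close> is Gaussian
  (\<open>gaussian_field_sum\<close>), and its means vanish by linearity.

  For the covariance, the one-point terms of the covariance of \<open>B\<close> cancel between increments
  (\<open>fbf_increment_covariance\<close>), so that the product of two sums of two increments has an
  expectation that depends on the displacement only. Its value at displacement zero is
  \<open>\<Sigma>\<^sup>2 * (4 * \<delta> powr (2 * H) - (sqrt 2 * \<delta>) powr (2 * H))\<close>, which is
  \<open>\<Sigma>\<^sup>2 * \<delta> powr (2 * H) * (4 - 2 powr H)\<close>; the normalising constant of \<open>Y\<close> is chosen to turn
  this into \<open>\<Sigma>\<^sup>2\<close>.

  Since integrals of non-integrable functions are zero by convention, linearity of expectation
  needs every product of two values of \<open>B\<close> to be integrable. This follows by polarisation from the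
  square integrability of Gaussian variables.
\<close>

lemma gaussian_rv_integrable:
  assumes "prob_space M" and X: "gaussian_rv M X"
  shows gaussian_rv_integrable_ident: "integrable M X"
    and gaussian_rv_integrable_square: "integrable M (\<lambda>\<omega>. (X \<omega>)\<^sup>2)"
proof -
  interpret prob_space M by fact
  have [measurable]: "X \<in> borel_measurable M"
    using X by (simp add: gaussian_rv_def)
  have power: "integrable M (\<lambda>\<omega>. X \<omega> ^ k)" for k
  proof (cases "\<exists>\<mu> \<sigma>. 0 < \<sigma> \<and> distributed M lborel X (normal_density \<mu> \<sigma>)")
    case True
    then obtain \<mu> \<sigma> where \<sigma>: "0 < \<sigma>" and D: "distributed M lborel X (normal_density \<mu> \<sigma>)"
      by blast
    \<comment> \<open>Expand \<open>X ^ k\<close> around \<open>\<mu>\<close>, because the moments at hand are the central ones.\<close>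
    have "integrable lborel (\<lambda>x. normal_density \<mu> \<sigma> x * x ^ k)"
    proof -
      have expand: "(\<lambda>x. normal_density \<mu> \<sigma> x * x ^ k) =
          (\<lambda>x. \<Sum>j\<le>k. (of_nat (k choose j) * \<mu> ^ (k - j)) * (normal_density \<mu> \<sigma> x * (x - \<mu>) ^ j))"
      proof
        fix x
        have "x ^ k = ((x - \<mu>) + \<mu>) ^ k" by simp
        also have "\<dots> = (\<Sum>j\<le>k. of_nat (k choose j) * (x - \<mu>) ^ j * \<mu> ^ (k - j))"
          by (rule binomial_ring)
        finally show "normal_density \<mu> \<sigma> x * x ^ k =
            (\<Sum>j\<le>k. (of_nat (k choose j) * \<mu> ^ (k - j)) * (normal_density \<mu> \<sigma> x * (x - \<mu>) ^ j))"
          by (simp add: sum_distrib_left mult_ac)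
      qed
      show ?thesis
        unfolding expand using integrable_normal_moment[OF \<sigma>]
        by (intro Bochner_Integration.integrable_sum integrable_mult_right) auto
    qed
    then show ?thesis
      by (subst (asm) distributed_integrable[OF D]) (use \<sigma> in auto)
  next
    case False
    then obtain \<mu> where "AE \<omega> in M. X \<omega> = \<mu>"
      using X unfolding gaussian_rv_def by blast
    then have "AE \<omega> in M. \<mu> ^ k = X \<omega> ^ k"
      by eventually_elim simp
    then show ?thesis
      by (rule integrable_cong_AE_imp[rotated 2]) auto
  qed
  show "integrable M X" "integrable M (\<lambda>\<omega>. (X \<omega>)\<^sup>2)"
    using power[of 1] power[of 2] by simp_all
qed

text \<open>
  Joint Gaussianity speaks of combinations over a set of distinct points. The points \<open>p i\<close> may
  coincide, in which case their coefficients are added up.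
\<close>

lemma gaussian_field_sum:
  assumes X: "gaussian_field M T X" and I: "finite I" and p: "p ` I \<subseteq> T"
  shows "gaussian_rv M (\<lambda>\<omega>. \<Sum>i\<in>I. a i * X (p i) \<omega>)"
proof -
  have "(\<Sum>i\<in>I. a i * X (p i) \<omega>) = (\<Sum>t\<in>p ` I. (\<Sum>i\<in>{i \<in> I. p i = t}. a i) * X t \<omega>)" for \<omega>
    by (subst sum.image_gen[OF I, of _ p]) (auto simp: sum_distrib_right intro!: sum.cong)
  then show ?thesis
    using X I p by (simp add: gaussian_field_def)
qed

lemma gaussian_field_component:
  assumes "gaussian_field M T X" "t \<in> T"
  shows "gaussian_rv M (X t)"
  using gaussian_field_sum[OF assms(1), of "{()}" "\<lambda>_. t" "\<lambda>_. 1"] assms(2) by simp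

lemma gaussian_field_integrable_product:
  assumes "prob_space M" and X: "gaussian_field M T X" and "s \<in> T" "t \<in> T"
  shows "integrable M (\<lambda>\<omega>. X s \<omega> * X t \<omega>)"
proof -
  have "gaussian_rv M (\<lambda>\<omega>. \<Sum>b\<in>UNIV. 1 * X (if b then s else t) \<omega>)"
    using assms by (intro gaussian_field_sum[OF X]) auto
  then have "gaussian_rv M (\<lambda>\<omega>. X s \<omega> + X t \<omega>)"
    by (simp add: UNIV_bool add.commute)
  then have "integrable M (\<lambda>\<omega>. ((X s \<omega> + X t \<omega>)\<^sup>2 - (X s \<omega>)\<^sup>2 - (X t \<omega>)\<^sup>2) / 2)"
    using assms gaussian_rv_integrable_square gaussian_field_component[OF X]
    by (intro integrable_divide_zero Bochner_Integration.integrable_diff) auto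
  then show ?thesis
    by (simp add: power2_sum)
qed

lemma fbf_increment_covariance:
  assumes M: "prob_space M" and B: "fractional_brownian_field M \<Sigma> H B"
  shows "integrable M (\<lambda>\<omega>. (B p \<omega> - B n \<omega>) * (B q \<omega> - B m \<omega>))" (is ?int)
    and "(\<integral>\<omega>. (B p \<omega> - B n \<omega>) * (B q \<omega> - B m \<omega>) \<partial>M) =
      \<Sigma>\<^sup>2 / 2 * (norm (p - m) powr (2 * H) + norm (n - q) powr (2 * H)
        - norm (p - q) powr (2 * H) - norm (n - m) powr (2 * H))" (is ?eq)
proof -
  have int: "integrable M (\<lambda>\<omega>. B s \<omega> * B t \<omega>)" for s t
    using B by (intro gaussian_field_integrable_product[OF M])
      (auto simp: fractional_brownian_field_def zero_mean_gaussian_field_def)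
  have cov: "(\<integral>\<omega>. B s \<omega> * B t \<omega> \<partial>M) =
      \<Sigma>\<^sup>2 / 2 * (norm s powr (2 * H) + norm t powr (2 * H) - norm (s - t) powr (2 * H))" for s t
    using B by (simp add: fractional_brownian_field_def)
  have expand: "(B p \<omega> - B n \<omega>) * (B q \<omega> - B m \<omega>) =
      B p \<omega> * B q \<omega> - B p \<omega> * B m \<omega> - B n \<omega> * B q \<omega> + B n \<omega> * B m \<omega>" for \<omega>
    by (simp add: algebra_simps)
  show ?int
    unfolding expand by (simp add: int)
  show ?eq
    unfolding expand by (simp add: int cov) (simp add: algebra_simps)
qed

text \<open>The unnormalised field has a covariance depending on the displacement \<open>d\<close> only.\<close>

lemma fbf_increment_sum_covariance:
  assumes M: "prob_space M" and B: "fractional_brownian_field M \<Sigma> H B"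
  shows "(\<integral>\<omega>. (B (n + d + u) \<omega> - B (n + d) \<omega> + B (n + d + v) \<omega> - B (n + d) \<omega>) *
              (B (n + u) \<omega> - B n \<omega> + B (n + v) \<omega> - B n \<omega>) \<partial>M) =
      \<Sigma>\<^sup>2 * (norm (d + u) powr (2 * H) + norm (d - u) powr (2 * H)
         + norm (d + v) powr (2 * H) + norm (d - v) powr (2 * H)
         - 3 * norm d powr (2 * H)
         - 1 / 2 * norm (d + u - v) powr (2 * H)
         - 1 / 2 * norm (d - u + v) powr (2 * H))"
proof -
  have expand: "(B (n + d + u) \<omega> - B (n + d) \<omega> + B (n + d + v) \<omega> - B (n + d) \<omega>) *
        (B (n + u) \<omega> - B n \<omega> + B (n + v) \<omega> - B n \<omega>) =
      (B (n + d + u) \<omega> - B (n + d) \<omega>) * (B (n + u) \<omega> - B n \<omega>)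
      + (B (n + d + u) \<omega> - B (n + d) \<omega>) * (B (n + v) \<omega> - B n \<omega>)
      + (B (n + d + v) \<omega> - B (n + d) \<omega>) * (B (n + u) \<omega> - B n \<omega>)
      + (B (n + d + v) \<omega> - B (n + d) \<omega>) * (B (n + v) \<omega> - B n \<omega>)" for \<omega>
    by (simp add: algebra_simps)
  have differences: "n + d + u - n = d + u" "n + d - (n + u) = d - u"
      "n + d + v - n = d + v" "n + d - (n + v) = d - v" "n + d - n = d"
      "n + d + u - (n + u) = d" "n + d + v - (n + v) = d"
      "n + d + u - (n + v) = d + u - v" "n + d + v - (n + u) = d - u + v"
    by (simp_all add: algebra_simps)
  show ?thesis
    unfolding expand
    by (simp add: fbf_increment_covariance[OF M B] differences del: add_diff_cancel_left)
      (simp add: field_simps)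
qed

lemma two_powr_less_four:
  fixes H :: real
  assumes "H < 1"
  shows "2 powr H < (4::real)"
proof -
  have "2 powr H < 2 powr (2::real)"
    using assms by (intro powr_less_mono) auto
  then show ?thesis by simp
qed

lemma normalising_constant_square:
  fixes H \<delta> :: real
  assumes "H < 1" and "\<delta> > 0"
  shows "(1 / (2 * \<delta> powr H * sqrt (1 - 2 powr (H - 2))))\<^sup>2 = \<delta> powr (- 2 * H) / (4 - 2 powr H)"
proof -
  have less: "2 powr H < (4::real)"
    using assms by (simp add: two_powr_less_four)
  have shift: "1 - 2 powr (H - 2) = (4 - 2 powr H) / (4::real)"
    by (simp add: powr_diff field_simps)
  have square: "(\<delta> powr H)\<^sup>2 = \<delta> powr (2 * H)"
    by (simp add: power2_eq_square flip: powr_add)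
  have "(1 / (2 * \<delta> powr H * sqrt (1 - 2 powr (H - 2))))\<^sup>2 =
      1 / (4 * \<delta> powr (2 * H) * ((4 - 2 powr H) / 4))"
    using less by (simp add: shift square power_divide power_mult_distrib)
  also have "\<dots> = \<delta> powr (- 2 * H) / (4 - 2 powr H)"
    by (simp add: powr_minus_divide)
  finally show ?thesis .
qed

lemma norm_scaled_axis_diff:
  assumes "\<delta> > 0"
  shows "norm (\<delta> *\<^sub>R e1 - \<delta> *\<^sub>R e2) = sqrt 2 * \<delta>"
proof -
  have "(norm (\<delta> *\<^sub>R e1 - \<delta> *\<^sub>R e2))\<^sup>2 = (sqrt 2 * \<delta>)\<^sup>2"
    unfolding power2_norm_eq_inner inner_vec_def
    by (simp add: sum_2 axis_def power2_eq_square)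
  then show ?thesis
    using assms by (simp add: power2_eq_iff_nonneg)
qed

text \<open>
  At displacement zero the covariance formula gives the variance. The term \<open>norm d powr (2 * H)\<close>
  vanishes there by the convention \<open>0 powr a = 0\<close>, so no lower bound on \<open>H\<close> is needed.
\<close>

lemma covariance_at_zero:
  fixes H \<delta> :: real
  assumes "H < 1" and "\<delta> > 0"
  defines "d \<equiv> (0 :: real^2)"
  shows "\<Sigma>\<^sup>2 * \<delta> powr (- 2 * H) / (4 - 2 powr H) *
        (norm (d + \<delta> *\<^sub>R e1) powr (2 * H) + norm (d - \<delta> *\<^sub>R e1) powr (2 * H)
         + norm (d + \<delta> *\<^sub>R e2) powr (2 * H) + norm (d - \<delta> *\<^sub>R e2) powr (2 * H)
         - 3 * norm d powr (2 * H)
         - 1 / 2 * norm (d + \<delta> *\<^sub>R e1 - \<delta> *\<^sub>R e2) powr (2 * H)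
         - 1 / 2 * norm (d - \<delta> *\<^sub>R e1 + \<delta> *\<^sub>R e2) powr (2 * H)) = \<Sigma>\<^sup>2"
proof -
  have norms: "norm (\<delta> *\<^sub>R e1) = \<delta>" "norm (\<delta> *\<^sub>R e2) = \<delta>"
    using assms by (simp_all add: norm_axis_1)
  have diag: "norm (\<delta> *\<^sub>R e1 - \<delta> *\<^sub>R e2) = sqrt 2 * \<delta>"
    using assms by (intro norm_scaled_axis_diff)
  then have diag': "norm (\<delta> *\<^sub>R e2 - \<delta> *\<^sub>R e1) = sqrt 2 * \<delta>"
    by (subst norm_minus_commute)
  have "sqrt 2 powr (2 * H) = (2 powr (1 / 2)) powr (2 * H)"
    by (simp only: powr_half_sqrt zero_le_numeral)
  also have "\<dots> = 2 powr H"
    by (simp only: powr_powr) simp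
  finally have "sqrt 2 powr (2 * H) = 2 powr H" .
  then have "(sqrt 2 * \<delta>) powr (2 * H) = 2 powr H * \<delta> powr (2 * H)"
    using assms by (simp add: powr_mult)
  then show ?thesis
    using assms two_powr_less_four[of H] unfolding d_def
    by (simp add: norms diag diag' powr_minus) (simp add: field_simps)
qed

theorem proposition4:
  fixes M :: "'a measure"
    and B Y :: "real^2 \<Rightarrow> 'a \<Rightarrow> real"
    and \<Sigma> H \<delta> :: real
    and N :: nat
  assumes "prob_space M"
    and "\<Sigma> > 0" and "0 < H" and "H < 1" and "\<delta> > 0"
    and "fractional_brownian_field M \<Sigma> H B"
    and "\<And>n \<omega>. n \<in> \<Upsilon> N \<Longrightarrow>
           Y n \<omega> = 1 / (2 * \<delta> powr H * sqrt (1 - 2 powr (H - 2))) *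
             (B (n + \<delta> *\<^sub>R e1) \<omega> - B n \<omega> + B (n + \<delta> *\<^sub>R e2) \<omega> - B n \<omega>)"
  shows "zero_mean_gaussian_field M (\<Upsilon> N) Y \<and>
    (\<forall>n \<in> \<Upsilon> N. (\<integral>\<omega>. (Y n \<omega>)\<^sup>2 \<partial>M) = \<Sigma>\<^sup>2) \<and>
    (\<forall>n \<Delta>n. n \<in> \<Upsilon> N \<longrightarrow> n + \<Delta>n \<in> \<Upsilon> N \<longrightarrow>
      (\<integral>\<omega>. Y (n + \<Delta>n) \<omega> * Y n \<omega> \<partial>M) =
        \<Sigma>\<^sup>2 * \<delta> powr (- 2 * H) / (4 - 2 powr H) *
        (norm (\<Delta>n + \<delta> *\<^sub>R e1) powr (2 * H) + norm (\<Delta>n - \<delta> *\<^sub>R e1) powr (2 * H)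
         + norm (\<Delta>n + \<delta> *\<^sub>R e2) powr (2 * H) + norm (\<Delta>n - \<delta> *\<^sub>R e2) powr (2 * H)
         - 3 * norm \<Delta>n powr (2 * H)
         - 1 / 2 * norm (\<Delta>n + \<delta> *\<^sub>R e1 - \<delta> *\<^sub>R e2) powr (2 * H)
         - 1 / 2 * norm (\<Delta>n - \<delta> *\<^sub>R e1 + \<delta> *\<^sub>R e2) powr (2 * H)))"
proof (intro conjI ballI allI impI)
  note M = \<open>prob_space M\<close> and B = \<open>fractional_brownian_field M \<Sigma> H B\<close>
  define c where "c = 1 / (2 * \<delta> powr H * sqrt (1 - 2 powr (H - 2)))"
  have Y: "Y n \<omega> = c * (B (n + \<delta> *\<^sub>R e1) \<omega> - B n \<omega> + B (n + \<delta> *\<^sub>R e2) \<omega> - B n \<omega>)"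
    if "n \<in> \<Upsilon> N" for n \<omega>
    using assms(7)[OF that] by (simp add: c_def)
  have gaussian: "gaussian_field M UNIV B" and mean: "(\<integral>\<omega>. B n \<omega> \<partial>M) = 0" for n
    using B by (auto simp: fractional_brownian_field_def zero_mean_gaussian_field_def)
  have int: "integrable M (B n)" for n
    by (intro gaussian_rv_integrable_ident[OF M] gaussian_field_component[OF gaussian]) simp
  show "zero_mean_gaussian_field M (\<Upsilon> N) Y"
    unfolding zero_mean_gaussian_field_def gaussian_field_def
  proof (intro conjI ballI allI impI; (elim conjE)?)
    fix F and a :: "real^2 \<Rightarrow> real"
    assume F: "finite F" "F \<subseteq> \<Upsilon> N"
    \<comment> \<open>Index the values of \<open>B\<close> by the base point and one of the three offsets.\<close>
    let ?I = "F \<times> {0, 1, 2 :: nat}"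
    let ?w = "\<lambda>k. [- 2, 1, 1 :: real] ! k" and ?u = "\<lambda>k. [0, \<delta> *\<^sub>R e1, \<delta> *\<^sub>R e2 :: real^2] ! k"
    have "gaussian_rv M (\<lambda>\<omega>. \<Sum>i\<in>?I. (a (fst i) * c * ?w (snd i)) * B (fst i + ?u (snd i)) \<omega>)"
      using F by (intro gaussian_field_sum[OF gaussian]) auto
    also have "(\<lambda>\<omega>. \<Sum>i\<in>?I. (a (fst i) * c * ?w (snd i)) * B (fst i + ?u (snd i)) \<omega>) =
        (\<lambda>\<omega>. \<Sum>t\<in>F. a t * Y t \<omega>)"
    proof
      fix \<omega>
      have "(\<Sum>i\<in>?I. (a (fst i) * c * ?w (snd i)) * B (fst i + ?u (snd i)) \<omega>) =
          (\<Sum>t\<in>F. \<Sum>k\<in>{0, 1, 2}. (a t * c * ?w k) * B (t + ?u k) \<omega>)"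
        by (simp only: sum.cartesian_product split_def)
      also have "\<dots> = (\<Sum>t\<in>F. a t * Y t \<omega>)"
      proof (rule sum.cong[OF refl])
        fix t assume "t \<in> F"
        then have "t \<in> \<Upsilon> N" using F by blast
        then show "(\<Sum>k\<in>{0, 1, 2}. (a t * c * ?w k) * B (t + ?u k) \<omega>) = a t * Y t \<omega>"
          by (simp add: Y algebra_simps)
      qed
      finally show "(\<Sum>i\<in>?I. (a (fst i) * c * ?w (snd i)) * B (fst i + ?u (snd i)) \<omega>) =
          (\<Sum>t\<in>F. a t * Y t \<omega>)" .
    qed
    finally show "gaussian_rv M (\<lambda>\<omega>. \<Sum>t\<in>F. a t * Y t \<omega>)" .
  next
    fix n assume "n \<in> \<Upsilon> N"
    then show "(\<integral>\<omega>. Y n \<omega> \<partial>M) = 0"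
      by (simp add: Y int mean)
  qed
  show covariance: "(\<integral>\<omega>. Y (n + \<Delta>n) \<omega> * Y n \<omega> \<partial>M) =
        \<Sigma>\<^sup>2 * \<delta> powr (- 2 * H) / (4 - 2 powr H) *
        (norm (\<Delta>n + \<delta> *\<^sub>R e1) powr (2 * H) + norm (\<Delta>n - \<delta> *\<^sub>R e1) powr (2 * H)
         + norm (\<Delta>n + \<delta> *\<^sub>R e2) powr (2 * H) + norm (\<Delta>n - \<delta> *\<^sub>R e2) powr (2 * H)
         - 3 * norm \<Delta>n powr (2 * H)
         - 1 / 2 * norm (\<Delta>n + \<delta> *\<^sub>R e1 - \<delta> *\<^sub>R e2) powr (2 * H)
         - 1 / 2 * norm (\<Delta>n - \<delta> *\<^sub>R e1 + \<delta> *\<^sub>R e2) powr (2 * H))"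
    if n: "n \<in> \<Upsilon> N" "n + \<Delta>n \<in> \<Upsilon> N" for n \<Delta>n
  proof -
    let ?Z = "\<lambda>n \<omega>. B (n + \<delta> *\<^sub>R e1) \<omega> - B n \<omega> + B (n + \<delta> *\<^sub>R e2) \<omega> - B n \<omega>"
    have "(\<integral>\<omega>. Y (n + \<Delta>n) \<omega> * Y n \<omega> \<partial>M) = (\<integral>\<omega>. c\<^sup>2 * (?Z (n + \<Delta>n) \<omega> * ?Z n \<omega>) \<partial>M)"
      unfolding Y[OF n(1)] Y[OF n(2)] by (simp only: power2_eq_square mult_ac)
    also have "\<dots> = c\<^sup>2 * (\<integral>\<omega>. ?Z (n + \<Delta>n) \<omega> * ?Z n \<omega> \<partial>M)"
      by (rule integral_mult_right_zero)
    also have "c\<^sup>2 = \<delta> powr (- 2 * H) / (4 - 2 powr H)"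
      unfolding c_def using assms by (intro normalising_constant_square) auto
    finally show ?thesis
      unfolding fbf_increment_sum_covariance[OF M B] by simp
  qed
  fix n assume n: "n \<in> \<Upsilon> N"
  have "(\<integral>\<omega>. (Y n \<omega>)\<^sup>2 \<partial>M) = (\<integral>\<omega>. Y (n + 0) \<omega> * Y n \<omega> \<partial>M)"
    by (simp add: power2_eq_square)
  also have "\<dots> = \<Sigma>\<^sup>2"
    using n assms by (subst covariance) (simp, simp, rule covariance_at_zero)
  finally show "(\<integral>\<omega>. (Y n \<omega>)\<^sup>2 \<partial>M) = \<Sigma>\<^sup>2" .
qed

end
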